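(* Let $\mathbb{V}$ be a finite-dimensional vector space over a field $\mathbb{F}$ and let $\mathcal{B}=\{v_1,\dots,v_n\}$ be a basis of $\mathbb{V}$. Then the nonzero component union graph $\mathbb{UG}(\mathbb{V})$ with respect to $\mathcal{B}$ is neither complemented nor uniquely complemented.
   Context: For $a=a_1v_1+\cdots+a_nv_n\in\mathbb{V}$ with $a_i\in\mathbb{F}$, put $S_{\mathcal{B}}(a)=\{v_i : a_i\neq 0\}$. The nonzero component union graph $\mathbb{UG}(\mathbb{V})$ is the simple graph with vertex set $\mathbb{V}\setminus\{0\}$ in which distinct vertices $a,b$ are adjacent iff $S_{\mathcal{B}}(a)\cup S_{\mathcal{B}}(b)=\mathcal{B}$. In a graph $G$, for distinct vertices $a,b$ write $a\bot b$ if $a$ and $b$ are adjacent and no vertex of $G$ is adjacent to both $a$ and $b$. $G$ is complemented if for each vertex $a$ there is a vertex $b$ with $a\bot b$. $G$ is uniquely complemented if it is complemented and whenever $a\bot b$ and $a\bot c$, then $b$ and $c$ are adjacent to exactly the same vertices.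
   Formalization: The basis is assumed nonempty (n ≥ 1), and the case n = 1 with a field of exactly three elements is excluded; in both the claim fails: the graph is empty, respectively a single edge, hence complemented and uniquely complemented. *)

theory Defs
  imports "Graph_Theory.Pair_Digraph"
begin

text \<open>
  Simple graphs, possibly infinite, are symmetric loop-free pair digraphs
  (locale \<^locale>\<open>pair_bidirected_digraph\<close>): the edge between \<open>a\<close> and \<open>b\<close> is
  represented by both arcs \<open>(a, b)\<close> and \<open>(b, a)\<close>.
\<close>

definition graph_perp :: "'v pair_pre_digraph \<Rightarrow> 'v \<Rightarrow> 'v \<Rightarrow> bool" where
  "graph_perp G a b \<longleftrightarrow>
     a \<in> pverts G \<and> b \<in> pverts G \<and> a \<noteq> b \<and> (a, b) \<in> parcs G \<and>
     \<not> (\<exists>c\<in>pverts G. (c, a) \<in> parcs G \<and> (c, b) \<in> parcs G)"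

definition complemented :: "'v pair_pre_digraph \<Rightarrow> bool" where
  "complemented G \<longleftrightarrow> (\<forall>a\<in>pverts G. \<exists>b\<in>pverts G. graph_perp G a b)"

definition uniquely_complemented :: "'v pair_pre_digraph \<Rightarrow> bool" where
  "uniquely_complemented G \<longleftrightarrow>
     complemented G \<and>
     (\<forall>a\<in>pverts G. \<forall>b\<in>pverts G. \<forall>c\<in>pverts G.
        graph_perp G a b \<longrightarrow> graph_perp G a c \<longrightarrow>
        (\<forall>x\<in>pverts G. (x, b) \<in> parcs G \<longleftrightarrow> (x, c) \<in> parcs G))"

context finite_dimensional_vector_space
begin

definition skeleton :: "'b \<Rightarrow> 'b set" where
  "skeleton a = {v \<in> Basis. representation Basis a v \<noteq> 0}"

lemma skeleton_sum: "skeleton (\<Sum>v\<in>Basis. c v *s v) = {v \<in> Basis. c v \<noteq> 0}"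
proof -
  have "representation Basis (\<Sum>v\<in>Basis. c v *s v) = (\<lambda>v. if v \<in> Basis then c v else 0)"
  proof (rule representation_eqI[OF independent_Basis])
    have "(\<Sum>b | (if b \<in> Basis then c b else 0) \<noteq> 0. (if b \<in> Basis then c b else 0) *s b)
        = (\<Sum>b\<in>Basis. (if b \<in> Basis then c b else 0) *s b)"
      by (rule sum.mono_neutral_left) (auto simp: finite_Basis)
    then show "(\<Sum>b | (if b \<in> Basis then c b else 0) \<noteq> 0. (if b \<in> Basis then c b else 0) *s b)
        = (\<Sum>v\<in>Basis. c v *s v)"
      by simp
    show "finite {b. (if b \<in> Basis then c b else 0) \<noteq> 0}"
      by (rule finite_subset[OF _ finite_Basis]) auto
  qed (auto simp: span_Basis split: if_splits)
  then show ?thesis by (auto simp: skeleton_def)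
qed

definition union_graph :: "'b pair_pre_digraph" where
  "union_graph =
     \<lparr> pverts = UNIV - {0},
       parcs = {(a, b). a \<noteq> 0 \<and> b \<noteq> 0 \<and> a \<noteq> b \<and> skeleton a \<union> skeleton b = Basis} \<rparr>"

lemma union_graph_simple: "pair_bidirected_digraph union_graph"
  by unfold_locales (auto simp: union_graph_def symmetric_def arcs_ends_def arc_to_ends_def
      with_proj_def sym_def)

end

end

theory Submission
  imports Defs
begin

(* The all-ones vector a has no orthogonal vertex.  Let b be another vertex.  If b has a zero
   coordinate, the 0/1 vector supported on the zero coordinates of b is a common neighbour of a
   and b.  If b has full support, every third vertex is a common neighbour, and a third vertex
   exists: a basis vector in dimension at least two, a further scalar multiple in dimension one. *)

context finite_dimensional_vector_space
begin

lemma skeleton_subset_Basis: "skeleton a \<subseteq> Basis"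
  by (auto simp: skeleton_def)

lemma skeleton_empty_iff: "skeleton a = {} \<longleftrightarrow> a = 0"
proof
  assume "skeleton a = {}"
  then have "representation Basis a v = 0" for v
    using representation_ne_zero by (auto simp: skeleton_def)
  moreover have "a = (\<Sum>v | representation Basis a v \<noteq> 0. representation Basis a v *s v)"
    using sum_nonzero_representation_eq[OF independent_Basis, of a] by (simp add: span_Basis)
  ultimately show "a = 0" by simp
qed (simp add: skeleton_def representation_zero)

text \<open>Coordinates in {0, 1} realise any prescribed support over any field.\<close>

lemma skeleton_sum_subset:
  assumes "A \<subseteq> Basis"
  shows "skeleton (\<Sum>A) = A"
proof -
  have "(\<Sum>v\<in>Basis. (if v \<in> A then 1 else 0) *s v) = (\<Sum>v\<in>A. (if v \<in> A then 1 else 0) *s v)"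
    using assms by (intro sum.mono_neutral_right) (auto simp: finite_Basis)
  then have "\<Sum>A = (\<Sum>v\<in>Basis. (if v \<in> A then 1 else 0) *s v)" by simp
  then show ?thesis using assms by (auto simp: skeleton_sum)
qed

text \<open>Supplies the common neighbour when \<open>b\<close> has full support. The excluded case
  is a line over a three-element field, whose only nonzero vectors are \<open>v\<close> and
  \<open>-v\<close>.\<close>

lemma third_nonzero_vector:
  assumes "card Basis \<ge> 1" and "\<not> (card Basis = 1 \<and> card (UNIV :: 'a set) = 3)"
    and "b \<noteq> 0" and "b \<noteq> \<Sum>Basis" and "skeleton b = Basis"
  shows "\<exists>c. c \<noteq> 0 \<and> c \<noteq> \<Sum>Basis \<and> c \<noteq> b"
proof (cases "card Basis = 1")
  case True
  then obtain v where v: "Basis = {v}" by (auto simp: card_1_singleton_iff)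
  have "v \<noteq> 0" using independent_Basis dependent_zero v by auto
  obtain k where k: "b = k *s v"
    using span_Basis v by (metis UNIV_I span_singleton rangeE)
  have "k \<noteq> 0" "k \<noteq> 1" using k v assms(3,4) by auto
  \<comment> \<open>The scalars to avoid are those of \<open>0\<close>, \<open>\<Sum>Basis\<close>
    and \<open>b\<close>; they are three distinct ones, so a field of any other size has a further
    scalar.\<close>
  then have "card {0, 1, k} = 3" by auto
  then have "{0, 1, k} \<noteq> UNIV" using assms(2) True by metis
  then obtain l where "l \<notin> {0, 1, k}" by auto
  then have "l *s v \<noteq> 0 \<and> l *s v \<noteq> \<Sum>Basis \<and> l *s v \<noteq> b"
    using k v \<open>v \<noteq> 0\<close> scale_cancel_right[of l v 1] by auto
  then show ?thesis by blast
next
  case False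
  obtain v where v: "v \<in> Basis" using assms(1) by fastforce
  then have sk: "skeleton v = {v}" using skeleton_sum_subset[of "{v}"] by simp
  \<comment> \<open>Both \<open>\<Sum>Basis\<close> and \<open>b\<close> have full support, so a
    vector of smaller support differs from both.\<close>
  then have "skeleton v \<noteq> Basis" using False by auto
  then have "v \<noteq> 0 \<and> v \<noteq> \<Sum>Basis \<and> v \<noteq> b"
    using sk skeleton_empty_iff[of v] skeleton_sum_subset[of Basis] assms(5) by auto
  then show ?thesis by blast
qed

lemma union_graph_not_complemented:
  assumes "card Basis \<ge> 1" and "\<not> (card Basis = 1 \<and> card (UNIV :: 'a set) = 3)"
  shows "\<not> complemented union_graph"
proof
  assume "complemented union_graph"
  have ska: "skeleton (\<Sum>Basis) = Basis" by (simp add: skeleton_sum_subset)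
  \<comment> \<open>A nonempty basis matters: the zero space gives a graph without vertices, which
    is vacuously complemented.\<close>
  then have "\<Sum>Basis \<noteq> 0" using skeleton_empty_iff[of "\<Sum>Basis"] assms(1) by auto
  then obtain b where perp: "graph_perp union_graph (\<Sum>Basis) b"
    using \<open>complemented union_graph\<close> by (auto simp: complemented_def union_graph_def)
  then have b: "b \<noteq> 0" "b \<noteq> \<Sum>Basis" by (auto simp: graph_perp_def union_graph_def)
  \<comment> \<open>Adjacency of \<open>c\<close> to \<open>\<Sum>Basis\<close> is automatic by full
    support, so only the union with \<open>skeleton b\<close> is required.\<close>
  have "\<exists>c. c \<noteq> 0 \<and> c \<noteq> \<Sum>Basis \<and> c \<noteq> b \<and> skeleton c \<union> skeleton b = Basis"
  proof (cases "skeleton b = Basis")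
    case True
    then show ?thesis
      using third_nonzero_vector[OF assms b] skeleton_subset_Basis by blast
  next
    case False
    let ?c = "\<Sum>(Basis - skeleton b)"
    have "skeleton ?c = Basis - skeleton b" by (simp add: skeleton_sum_subset)
    moreover have "skeleton b \<noteq> {}" using b skeleton_empty_iff by simp
    \<comment> \<open>Comparing supports is enough to separate \<open>?c\<close> from
      \<open>0\<close>, \<open>\<Sum>Basis\<close> and \<open>b\<close>.\<close>
    ultimately have "skeleton ?c \<noteq> {}" "skeleton ?c \<noteq> Basis" "skeleton ?c \<noteq> skeleton b"
      "skeleton ?c \<union> skeleton b = Basis"
      using False skeleton_subset_Basis[of b] by auto
    then show ?thesis using ska skeleton_empty_iff by metis
  qed
  then show False
    using perp ska skeleton_subset_Basis \<open>\<Sum>Basis \<noteq> 0\<close>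
    by (auto simp: graph_perp_def union_graph_def)
qed

end

theorem theorem3p7:
  fixes scale :: "'f::field \<Rightarrow> 'v::ab_group_add \<Rightarrow> 'v"
    and B :: "'v set"
  assumes "finite_dimensional_vector_space scale B"
    and "card B \<ge> 1"
    and "\<not> (card B = 1 \<and> card (UNIV :: 'f set) = 3)"
  shows "\<not> complemented (finite_dimensional_vector_space.union_graph scale B)
       \<and> \<not> uniquely_complemented (finite_dimensional_vector_space.union_graph scale B)"
  using finite_dimensional_vector_space.union_graph_not_complemented[OF assms]
  by (simp add: uniquely_complemented_def)

end
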